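(* Let $m,n\ge 2$ be integers, let $S=\{s_{1},s_{2},\ldots,s_{n}\}$ be a set of $n$ distinct positive integers, and let $F=\{f_{1},f_{2},\ldots,f_{l}\}$ be a factor-closed set (of $l$ distinct positive integers) containing $S$. Then the $m$th-order $n$-dimensional GCD tensor $\mathcal{T}_{[S]}$ can be expressed as \[\mathcal{T}_{[S]}=\mathcal{D}\times_{1}E\times_{2}E\times_{3}\cdots\times_{m}E,\] where $\mathcal{D}\in\mathbb{R}^{[m,l]}$ is the diagonal tensor with diagonal entries $d_{ii\ldots i}=\Phi(f_{i})$, $1\le i\le l$ ($\Phi$ being Euler's totient function), and $E=(e_{ij})\in\mathbb{R}^{n\times l}$ is given by $e_{ij}=1$ if $f_{j}$ divides $s_{i}$, and $e_{ij}=0$ otherwise.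
   Context: $\mathbb{R}^{[m,n]}$ denotes the set of real $m$th-order $n$-dimensional tensors $\mathcal{A}=(a_{i_1 i_2\ldots i_m})$, $1\le i_1,\ldots,i_m\le n$. A tensor is diagonal if all entries other than those of the form $a_{ii\ldots i}$ are zero. GCD tensor: for $S=\{s_1,\ldots,s_n\}$ with $n$ distinct positive integers (listed in a fixed order), $\mathcal{T}_{[S]}=(t_{i_1\ldots i_m})\in\mathbb{R}^{[m,n]}$ with $t_{i_1 i_2\ldots i_m}=\gcd(s_{i_1},s_{i_2},\ldots,s_{i_m})$. A set $F$ of positive integers is factor-closed if whenever a positive integer $d$ divides some $f\in F$, then $d\in F$. $k$-mode product: for $\mathcal{A}\in\mathbb{R}^{I_1\times\cdots\times I_m}$ and $B\in\mathbb{R}^{J\times I_k}$, $(\mathcal{A}\times_k B)_{i_1\ldots i_{k-1}\,j\,i_{k+1}\ldots i_m}=\sum_{i_k=1}^{I_k}\mathcal{A}_{i_1\ldots i_{k-1}i_k i_{k+1}\ldots i_m}B_{j i_k}$. *)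

theory Defs
  imports "Jordan_Normal_Form.Matrix" "HOL-Number_Theory.Totient"
begin

text \<open>As for the matrices of Jordan_Normal_Form.Matrix, indices start at 0 and the sizes are
  part of the value: a tensor is the list of its dimensions together with its entries. A
  multi-index is a list, and \<^const>\<open>undefined\<close> is stored at the lists that are no multi-index of
  the tensor, so that two tensors are equal iff their dimensions and all their entries agree.\<close>

definition multi_indices :: "nat list \<Rightarrow> nat list set" where
  "multi_indices ds = {is. length is = length ds \<and> (\<forall>k < length ds. is ! k < ds ! k)}"

typedef 'a tensor =
  "{(ds :: nat list, f :: nat list \<Rightarrow> 'a). \<forall>is. is \<notin> multi_indices ds \<longrightarrow> f is = undefined}"
  by (rule exI[of _ "([], \<lambda>_. undefined)"]) simp

setup_lifting type_definition_tensor

lift_definition dims :: "'a tensor \<Rightarrow> nat list" is fst .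

lift_definition entry :: "'a tensor \<Rightarrow> nat list \<Rightarrow> 'a" is snd .

lift_definition tensor :: "nat list \<Rightarrow> (nat list \<Rightarrow> 'a) \<Rightarrow> 'a tensor" is
  "\<lambda>ds f. (ds, \<lambda>is. if is \<in> multi_indices ds then f is else undefined)"
  by simp

lemma dims_tensor [simp]: "dims (tensor ds f) = ds"
  by transfer simp

lemma entry_tensor [simp]: "is \<in> multi_indices ds \<Longrightarrow> entry (tensor ds f) is = f is"
  by transfer simp

lemma tensor_eqI:
  assumes "dims A = dims B"
    and "\<And>is. is \<in> multi_indices (dims B) \<Longrightarrow> entry A is = entry B is"
  shows "A = B"
  using assms by transfer (auto simp: fun_eq_iff, metis)

text \<open>The product is meaningful when \<open>k < length (dims A)\<close> and \<open>dim_col B = dims A ! k\<close>; the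
  modes are numbered from 0.\<close>

definition mode_prod :: "'a :: comm_semiring_0 tensor \<Rightarrow> nat \<Rightarrow> 'a mat \<Rightarrow> 'a tensor" where
  "mode_prod A k B = tensor ((dims A)[k := dim_row B])
     (\<lambda>is. \<Sum>i < dims A ! k. entry A (is[k := i]) * B $$ (is ! k, i))"

text \<open>The tensors of order \<open>m\<close> and dimension \<open>n\<close> are those with dimensions \<open>replicate m n\<close>.\<close>

definition diag_tensor :: "nat \<Rightarrow> nat \<Rightarrow> (nat \<Rightarrow> 'a :: zero) \<Rightarrow> 'a tensor" where
  "diag_tensor m n d = tensor (replicate m n)
     (\<lambda>is. if is = replicate m (hd is) then d (hd is) else 0)"

lemma entry_diag_tensor:
  assumes "m > 0"
  shows "i < n \<Longrightarrow> entry (diag_tensor m n d) (replicate m i) = d i"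
    and "is \<in> multi_indices (replicate m n) \<Longrightarrow> \<nexists>i. is = replicate m i \<Longrightarrow>
           entry (diag_tensor m n d) is = 0"
  using assms by (auto simp: diag_tensor_def multi_indices_def)

definition gcd_tensor :: "nat \<Rightarrow> nat list \<Rightarrow> real tensor" where
  "gcd_tensor m ss = tensor (replicate m (length ss))
     (\<lambda>is. real (Gcd {ss ! i | i. i \<in> set is}))"

definition factor_closed :: "nat set \<Rightarrow> bool" where
  "factor_closed F \<longleftrightarrow> (\<forall>f \<in> F. \<forall>d > 0. d dvd f \<longrightarrow> d \<in> F)"

definition divisor_mat :: "nat list \<Rightarrow> nat list \<Rightarrow> real mat" where
  "divisor_mat ss fs = mat (length ss) (length fs)
     (\<lambda>(i, j). if fs ! j dvd ss ! i then 1 else 0)"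

end

theory Submission
  imports Defs
begin

text \<open>A diagonal tensor with diagonal entries \<open>d j\<close> is the sum over \<open>j\<close> of \<open>d j\<close> times the
  \<open>m\<close>-fold outer product of the \<open>j\<close>-th unit vector with itself. A mode product with \<open>B\<close> replaces
  one unit vector of every summand by the \<open>j\<close>-th column of \<open>B\<close>, so that the product in all
  modes has the entries \<open>\<Sum>j. d j * (\<Prod>k<m. B $$ (is ! k, j))\<close>
  (\<open>foldl_mode_prod_diag_tensor\<close>).

  When \<open>B\<close> is the divisor matrix, the product over \<open>k\<close> is the indicator of the event that the
  \<open>j\<close>-th element of \<open>F\<close> divides \<open>s\<^sub>i\<close> for all \<open>i\<close> in \<open>is\<close>, that is, divides their gcd \<open>g\<close>. As \<open>F\<close> is
  factor-closed and contains the \<open>s\<^sub>i\<close>, it contains every divisor of \<open>g\<close>, and the entry is the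
  sum of the totients of all divisors of \<open>g\<close>. By Gauss's identity this sum is \<open>g\<close>
  (\<open>sum_totient_factor_closed\<close>).\<close>

text \<open>This is the outer product expansion after the first \<open>p\<close> modes have been multiplied. In the
  modes from \<open>p\<close> on, the unit vectors are still there, and their entries multiply to the
  indicator \<open>\<forall>k. p \<le> k \<and> k < m \<longrightarrow> is ! k = j\<close>.\<close>

lemma foldl_mode_prod_diag_tensor_partial:
  fixes d :: "nat \<Rightarrow> 'a :: comm_semiring_1"
  assumes "m > 0" and "dim_col B = l" and "p \<le> m"
  shows "foldl (\<lambda>A k. mode_prod A k B) (diag_tensor m l d) [0..<p] =
    tensor (map (\<lambda>k. if k < p then dim_row B else l) [0..<m])
      (\<lambda>is. \<Sum>j<l. if \<forall>k. p \<le> k \<and> k < m \<longrightarrow> is ! k = j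
                   then d j * (\<Prod>k<p. B $$ (is ! k, j)) else 0)"
    (is "_ = tensor (?ds p) (?f p)")
  using \<open>p \<le> m\<close>
proof (induction p)
  case 0
  show ?case
  proof (rule tensor_eqI, goal_cases)
    case 1
    then show ?case by (simp add: diag_tensor_def map_replicate_const)
  next
    case (2 "is")
    then have mi: "is \<in> multi_indices (replicate m l)"
      by (simp add: map_replicate_const)
    have len: "length is = m" and hd: "hd is < l"
      using mi \<open>m > 0\<close> by (auto simp: multi_indices_def hd_conv_nth)
    have const_iff: "(\<forall>k<m. is ! k = j) \<longleftrightarrow> is = replicate m (hd is) \<and> hd is = j" for j
    proof
      assume all: "\<forall>k<m. is ! k = j"
      then have "is = replicate m j"
        using len by (intro nth_equalityI) auto
      then show "is = replicate m (hd is) \<and> hd is = j"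
        using \<open>m > 0\<close> by simp
    next
      assume "is = replicate m (hd is) \<and> hd is = j"
      then show "\<forall>k<m. is ! k = j"
        by (metis nth_replicate)
    qed
    have "?f 0 is = (\<Sum>j<l. if hd is = j then if is = replicate m (hd is) then d j else 0 else 0)"
      by (intro sum.cong refl) (simp add: const_iff)
    also have "\<dots> = (if is = replicate m (hd is) then d (hd is) else 0)"
      using hd by simp
    finally show ?case
      using mi by (simp add: diag_tensor_def map_replicate_const)
  qed
next
  case (Suc p)
  then have "p < m" by simp
  have dims: "(?ds p)[p := dim_row B] = ?ds (Suc p)"
    using \<open>p < m\<close> by (intro nth_equalityI) (auto simp: nth_list_update less_Suc_eq)
  have IH: "foldl (\<lambda>A k. mode_prod A k B) (diag_tensor m l d) [0..<p] = tensor (?ds p) (?f p)"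
    using Suc by simp
  have "foldl (\<lambda>A k. mode_prod A k B) (diag_tensor m l d) [0..<Suc p] =
      mode_prod (tensor (?ds p) (?f p)) p B"
    using IH by simp
  also have "\<dots> = tensor (?ds (Suc p)) (?f (Suc p))"
  proof (rule tensor_eqI, goal_cases)
    case 1
    then show ?case by (simp only: mode_prod_def dims dims_tensor)
  next
    case (2 "is")
    then have mi: "is \<in> multi_indices (?ds (Suc p))" by simp
    then have len: "length is = m" by (simp add: multi_indices_def)
    have upd: "is[p := i] \<in> multi_indices (?ds p)" if "i < l" for i
      using mi that by (auto simp: multi_indices_def nth_list_update)
    \<comment> \<open>The condition \<open>i = j\<close> is the remaining unit vector in mode \<open>p\<close>; summed over \<open>i\<close>
      against \<open>B $$ (is ! p, i)\<close>, it leaves the factor \<open>B $$ (is ! p, j)\<close>.\<close>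
    have all_iff: "(\<forall>k. p \<le> k \<and> k < m \<longrightarrow> is[p := i] ! k = j) \<longleftrightarrow>
        i = j \<and> (\<forall>k. Suc p \<le> k \<and> k < m \<longrightarrow> is ! k = j)" for i j
    proof -
      have "is[p := i] ! k = (if k = p then i else is ! k)" if "k < m" for k
        using that len by (simp add: nth_list_update)
      moreover have "p \<le> k \<longleftrightarrow> k = p \<or> Suc p \<le> k" for k
        by auto
      ultimately show ?thesis
        using \<open>p < m\<close> by (metis Suc_n_not_le_n)
    qed
    have "entry (mode_prod (tensor (?ds p) (?f p)) p B) is =
        (\<Sum>i<?ds p ! p. entry (tensor (?ds p) (?f p)) (is[p := i]) * B $$ (is ! p, i))"
      using mi by (simp only: mode_prod_def dims_tensor dims entry_tensor)
    also have "\<dots> = (\<Sum>i<l. ?f p (is[p := i]) * B $$ (is ! p, i))"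
      using \<open>p < m\<close> upd by (intro sum.cong) auto
    also have "\<dots> = (\<Sum>i<l. \<Sum>j<l. if i = j then
        (if \<forall>k. Suc p \<le> k \<and> k < m \<longrightarrow> is ! k = j
         then d j * (\<Prod>k<Suc p. B $$ (is ! k, j)) else 0) else 0)"
      unfolding all_iff sum_distrib_right
      by (intro sum.cong refl) (auto simp: mult_ac)
    also have "\<dots> = ?f (Suc p) is"
      by (intro sum.cong refl) simp
    finally show ?case
      using mi by (simp only: entry_tensor)
  qed
  finally show ?case .
qed

lemma foldl_mode_prod_diag_tensor:
  fixes d :: "nat \<Rightarrow> 'a :: comm_semiring_1"
  assumes "m > 0" and "dim_col B = l"
  shows "foldl (\<lambda>A k. mode_prod A k B) (diag_tensor m l d) [0..<m] =
    tensor (replicate m (dim_row B)) (\<lambda>is. \<Sum>j<l. d j * (\<Prod>k<m. B $$ (is ! k, j)))"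
proof -
  have "map (\<lambda>k. if k < m then dim_row B else l) [0..<m] = replicate m (dim_row B)"
    by (rule nth_equalityI) auto
  then show ?thesis
    using foldl_mode_prod_diag_tensor_partial[OF assms order_refl, of d] by simp
qed

text \<open>Every divisor of \<open>g\<close> divides an element of \<open>F\<close> and so belongs to \<open>F\<close>; hence the sum runs
  over all divisors of \<open>g\<close>, and Gauss's identity applies.\<close>

lemma sum_totient_factor_closed:
  assumes "factor_closed F" and "s \<in> F" and "s > 0" and "g dvd s"
  shows "(\<Sum>f | f \<in> F \<and> f dvd g. totient f) = g"
proof -
  have "g > 0"
    using assms(3,4) by (auto intro: Nat.gr0I)
  have "f \<in> F" if "f dvd g" for f
  proof -
    have "f dvd s" "f > 0"
      using that \<open>g > 0\<close> \<open>g dvd s\<close> by (auto intro: Nat.gr0I dvd_trans)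
    then show ?thesis
      using assms(1,2) by (auto simp: factor_closed_def)
  qed
  then have "{f. f \<in> F \<and> f dvd g} = {f. f dvd g}" by auto
  then show ?thesis by (simp add: totient_divisor_sum)
qed

theorem lemma3p7:
  fixes m n l :: nat and ss fs :: "nat list"
  assumes "m \<ge> 2" and "n \<ge> 2"
    and "length ss = n" and "distinct ss" and "\<forall>s \<in> set ss. s > 0"
    and "length fs = l" and "distinct fs" and "\<forall>f \<in> set fs. f > 0"
    and "factor_closed (set fs)" and "set ss \<subseteq> set fs"
  defines "D \<equiv> diag_tensor m l (\<lambda>i. real (totient (fs ! i)))"
    and "E \<equiv> divisor_mat ss fs"
  shows "gcd_tensor m ss = foldl (\<lambda>A k. mode_prod A k E) D [0..<m]"
proof -
  have "m > 0" using \<open>m \<ge> 2\<close> by simp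
  have dim: "dim_row E = n" "dim_col E = l"
    using assms by (simp_all add: divisor_mat_def)
  have "gcd_tensor m ss =
      tensor (replicate m n) (\<lambda>is. \<Sum>j<l. real (totient (fs ! j)) * (\<Prod>k<m. E $$ (is ! k, j)))"
  proof (rule tensor_eqI, goal_cases)
    case 1
    then show ?case using \<open>length ss = n\<close> by (simp add: gcd_tensor_def)
  next
    case (2 "is")
    then have mi: "is \<in> multi_indices (replicate m n)" by simp
    then have len: "length is = m" and less: "\<And>k. k < m \<Longrightarrow> is ! k < n"
      by (auto simp: multi_indices_def)
    define g where "g = Gcd {ss ! i | i. i \<in> set is}"
    have dvd_g_iff: "f dvd g \<longleftrightarrow> (\<forall>k<m. f dvd ss ! (is ! k))" for f
      unfolding g_def dvd_Gcd_iff using len by (auto simp: in_set_conv_nth)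
    have s: "ss ! (is ! 0) \<in> set ss"
      using less[OF \<open>m > 0\<close>] \<open>length ss = n\<close> by simp
    have "(\<Prod>k<m. E $$ (is ! k, j)) = (if fs ! j dvd g then 1 else 0)" if "j < l" for j
    proof -
      have "(\<Prod>k<m. E $$ (is ! k, j)) = (\<Prod>k<m. if fs ! j dvd ss ! (is ! k) then 1 else 0)"
        using that less assms(3,6) by (intro prod.cong) (auto simp: E_def divisor_mat_def)
      then show ?thesis by (auto simp: dvd_g_iff)
    qed
    then have "(\<Sum>j<l. real (totient (fs ! j)) * (\<Prod>k<m. E $$ (is ! k, j))) =
        (\<Sum>j<l. if fs ! j dvd g then real (totient (fs ! j)) else 0)"
      by (intro sum.cong) auto
    also have "\<dots> = (\<Sum>f\<in>set fs. if f dvd g then real (totient f) else 0)"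
      using assms(6,7) by (intro sum.reindex_bij_betw bij_betw_nth) auto
    also have "\<dots> = real (\<Sum>f | f \<in> set fs \<and> f dvd g. totient f)"
      by (simp add: sum.If_cases Int_def)
    also have "(\<Sum>f | f \<in> set fs \<and> f dvd g. totient f) = g"
      using s assms(5,9,10) dvd_g_iff[of g] \<open>m > 0\<close>
      by (intro sum_totient_factor_closed[where s = "ss ! (is ! 0)"]) auto
    finally show ?case
      using mi \<open>length ss = n\<close> by (simp add: gcd_tensor_def g_def)
  qed
  then show ?thesis
    using foldl_mode_prod_diag_tensor[OF \<open>m > 0\<close> dim(2)] dim by (simp add: D_def)
qed

end
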